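(* Let $G$ be a subgroup of the additive group $\mathbb{Q}$ of rational numbers and let $X\subseteq G$ be a subset. Then $X$ is semiaffine if and only if at least one of the following conditions holds: (1) $X=(H+a)\cup(H+b)$ for some subgroup $H$ of $G$ and some elements $a,b\in X$; (2) $X=(H\setminus(P\cap C))+g$ for some $g\in G$, some order-convex set $C$ in $\mathbb{Q}$ and some subgroups $P\subseteq H$ of $G$ such that the quotient group $H/P$ contains no elements of even order.
   Context: A subset $X$ of an Abelian group $G$ is called semiaffine if for all $x,y,z\in X$ we have $x+(y-z)\in X$ or $x-(y-z)\in X$. (The empty set is semiaffine.) A subset $C\subseteq\mathbb{Q}$ is order-convex in $\mathbb{Q}$ if for all $x\le y$ in $C$ the order interval $\{z\in\mathbb{Q}:x\le z\le y\}$ is a subset of $C$. The order of an element $g$ of a group is the smallest positive integer $n$ with $ng=0$; if $ng\neq 0$ for all positive integers $n$, then $g$ has infinite order. An element has even order if its order is finite and even. For a subset $A\subseteq G$ and $g\in G$, $A+g:=\{u+g:u\in A\}$. *)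

theory Defs
  imports Complex_Main "HOL-Algebra.Multiplicative_Group"
begin

definition rational_group :: "rat monoid"
  where "rational_group = \<lparr>carrier = UNIV, monoid.mult = (+), one = 0\<rparr>"

lemma comm_group_rational_group: "comm_group rational_group"
  by (rule comm_groupI) (auto simp: rational_group_def intro: exI[of _ "- _"])

text \<open>In additive notation the two elements are \<open>x + (y - z)\<close> and \<open>x - (y - z)\<close>.\<close>

definition semiaffine :: "('a, 'b) monoid_scheme \<Rightarrow> 'a set \<Rightarrow> bool"
  where "semiaffine G X \<longleftrightarrow> X \<subseteq> carrier G \<and>
    (\<forall>x\<in>X. \<forall>y\<in>X. \<forall>z\<in>X.
      x \<otimes>\<^bsub>G\<^esub> (y \<otimes>\<^bsub>G\<^esub> inv\<^bsub>G\<^esub> z) \<in> X \<or> x \<otimes>\<^bsub>G\<^esub> inv\<^bsub>G\<^esub> (y \<otimes>\<^bsub>G\<^esub> inv\<^bsub>G\<^esub> z) \<in> X)"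

definition order_convex :: "'a::order set \<Rightarrow> bool"
  where "order_convex C \<longleftrightarrow> (\<forall>x\<in>C. \<forall>y\<in>C. x \<le> y \<longrightarrow> {x..y} \<subseteq> C)"

text \<open>The library's \<open>group.ord\<close> is \<open>0\<close> at elements of infinite order, and \<open>0\<close> is an even number.\<close>

definition has_even_order :: "('a, 'b) monoid_scheme \<Rightarrow> 'a \<Rightarrow> bool"
  where "has_even_order G x \<longleftrightarrow> group.ord G x > 0 \<and> even (group.ord G x)"

end

theory Submission
  imports Defs
begin

text \<open>Fix \<open>x\<^sub>0 \<in> X\<close> and let \<open>D = X - X\<close>. If \<open>D\<close> is not a subgroup, then \<open>X\<close> is a union of two cosets,
  in any abelian group. If \<open>D\<close> is a subgroup, then the complement of \<open>X - x\<^sub>0\<close> in \<open>D\<close> contains the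
  midpoint \<open>w\<close> of \<open>w + t\<close> and \<open>w - t\<close> as soon as it contains these two points. Such a midconvex set of
  integers is the part of an arithmetic progression of odd step between its extreme points; as
  finitely generated subgroups of the rationals are cyclic, a midconvex subset of \<open>D\<close> is the part of
  a coset of a subgroup \<open>P\<close> in an order-convex set, and the odd steps make \<open>D/P\<close> free of elements of
  even order.\<close>

section \<open>Subgroups in additive notation\<close>

text \<open>The one-step subgroup criterion, phrased for the type class \<open>ab_group_add\<close>
  so that the two-coset argument can run without group records; \<open>0 \<in> H\<close> excludes
  the empty set.\<close>

definition subtraction_closed :: "'a::ab_group_add set \<Rightarrow> bool"
  where "subtraction_closed H \<longleftrightarrow> 0 \<in> H \<and> (\<forall>x\<in>H. \<forall>y\<in>H. x - y \<in> H)"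

lemma subtraction_closedD:
  assumes "subtraction_closed H"
  shows "0 \<in> H" "\<And>x y. x \<in> H \<Longrightarrow> y \<in> H \<Longrightarrow> x - y \<in> H"
    "\<And>x. x \<in> H \<Longrightarrow> - x \<in> H" "\<And>x y. x \<in> H \<Longrightarrow> y \<in> H \<Longrightarrow> x + y \<in> H"
proof -
  show 0: "0 \<in> H" and d: "\<And>x y. x \<in> H \<Longrightarrow> y \<in> H \<Longrightarrow> x - y \<in> H"
    using assms by (auto simp: subtraction_closed_def)
  show m: "- x \<in> H" if "x \<in> H" for x using d[OF 0 that] by simp
  show "x + y \<in> H" if "x \<in> H" "y \<in> H" for x y using d[OF that(1) m[OF that(2)]] by simp
qed

lemma subtraction_closed_of_int:
  fixes H :: "'a::ring_1 set"
  assumes H: "subtraction_closed H" and x: "x \<in> H"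
  shows "of_int n * x \<in> H"
proof (induction n rule: int_induct[where k = 0])
  case base
  then show ?case using subtraction_closedD(1)[OF H] by simp
next
  case (step1 i)
  then show ?case using subtraction_closedD(4)[OF H step1(2) x] by (simp add: algebra_simps)
next
  case (step2 i)
  then show ?case using subtraction_closedD(2)[OF H step2(2) x] by (simp add: algebra_simps)
qed

lemma inv_rational_group: "inv\<^bsub>rational_group\<^esub> x = - x"
  by (rule group.inv_equality)
    (auto simp: rational_group_def intro: comm_group_rational_group[unfolded rational_group_def comm_group_def, THEN conjunct2])

lemma subgroup_rational_group_iff:
  "subgroup G rational_group \<longleftrightarrow> subtraction_closed G"
proof
  assume G: "subgroup G rational_group"
  show "subtraction_closed G"
    unfolding subtraction_closed_def
    using subgroup.one_closed[OF G] subgroup.m_closed[OF G] subgroup.m_inv_closed[OF G]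
    by (auto simp: inv_rational_group) (auto simp: rational_group_def diff_conv_add_uminus simp del: add_uminus_conv_diff)
next
  assume G: "subtraction_closed G"
  show "subgroup G rational_group"
    by (rule subgroup.intro)
      (use subtraction_closedD[OF G] in \<open>auto simp: inv_rational_group, auto simp: rational_group_def\<close>)
qed

lemma subgroup_rational_subgroup_iff:
  assumes "subtraction_closed G"
  shows "subgroup H (rational_group\<lparr>carrier := G\<rparr>) \<longleftrightarrow> subtraction_closed H \<and> H \<subseteq> G"
proof -
  interpret comm_group rational_group by (rule comm_group_rational_group)
  have G: "subgroup G rational_group" using assms by (simp add: subgroup_rational_group_iff)
  show ?thesis
    using subgroup_incl[OF _ G] incl_subgroup[OF G] subgroup.subset[of H "rational_group\<lparr>carrier := G\<rparr>"]
    by (auto simp: subgroup_rational_group_iff)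
qed

lemma semiaffine_rational_iff:
  assumes "subtraction_closed G" "X \<subseteq> G"
  shows "semiaffine (rational_group\<lparr>carrier := G\<rparr>) X \<longleftrightarrow>
    (\<forall>x\<in>X. \<forall>y\<in>X. \<forall>z\<in>X. x + (y - z) \<in> X \<or> x - (y - z) \<in> X)"
proof -
  interpret comm_group rational_group by (rule comm_group_rational_group)
  have G: "subgroup G rational_group" using assms by (simp add: subgroup_rational_group_iff)
  have inv: "inv\<^bsub>rational_group\<lparr>carrier := G\<rparr>\<^esub> x = - x" if "x \<in> G" for x
    using m_inv_consistent[OF G that] by (simp add: inv_rational_group)
  have op: "x \<otimes>\<^bsub>rational_group\<lparr>carrier := G\<rparr>\<^esub> y = x + y" for x y
    by (simp add: rational_group_def)
  \<comment> \<open>Inverses of the restricted structure are identified with negation only inside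
    \<open>G\<close>, so the differences have to be placed in \<open>G\<close> first.\<close>
  have "y - z \<in> G" if "y \<in> X" "z \<in> X" for y z
    using that assms subtraction_closedD(2)[OF assms(1)] by auto
  then have "inv\<^bsub>rational_group\<lparr>carrier := G\<rparr>\<^esub> (y - z) = z - y" "inv\<^bsub>rational_group\<lparr>carrier := G\<rparr>\<^esub> z = - z"
    if "y \<in> X" "z \<in> X" for y z
    using that inv assms(2) by auto
  then have "x \<otimes>\<^bsub>rational_group\<lparr>carrier := G\<rparr>\<^esub> (y \<otimes>\<^bsub>rational_group\<lparr>carrier := G\<rparr>\<^esub> inv\<^bsub>rational_group\<lparr>carrier := G\<rparr>\<^esub> z) = x + (y - z)"
    "x \<otimes>\<^bsub>rational_group\<lparr>carrier := G\<rparr>\<^esub> inv\<^bsub>rational_group\<lparr>carrier := G\<rparr>\<^esub> (y \<otimes>\<^bsub>rational_group\<lparr>carrier := G\<rparr>\<^esub> inv\<^bsub>rational_group\<lparr>carrier := G\<rparr>\<^esub> z) = x - (y - z)"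
    if "y \<in> X" "z \<in> X" for x y z
    unfolding op using that by simp_all
  then show ?thesis
    using assms(2) unfolding semiaffine_def by simp
qed

section \<open>Elements of even order in a quotient\<close>

text \<open>An element of order \<open>2 * k\<close> with \<open>k > 0\<close> has an involution as
  its \<open>k\<close>-th power, so excluding elements of even order amounts to excluding
  involutions.\<close>

lemma (in group) no_even_order_iff:
  "(\<forall>x \<in> carrier G. \<not> has_even_order G x) \<longleftrightarrow>
    (\<forall>x \<in> carrier G. x \<otimes> x = \<one> \<longrightarrow> x = \<one>)"
proof (intro iffI ballI impI)
  fix x assume no: "\<forall>x \<in> carrier G. \<not> has_even_order G x" and x: "x \<in> carrier G" "x \<otimes> x = \<one>"
  have "x [^] (2::nat) = \<one>" using x by (simp add: numeral_2_eq_2)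
  then have dvd: "ord x dvd 2" using x pow_eq_id by simp
  then have "ord x = 1 \<or> ord x = 2"
    using dvd_imp_le[OF dvd] by (cases "ord x" rule: nat.exhaust) (auto simp: le_Suc_eq numeral_2_eq_2)
  then show "x = \<one>" using no x ord_eq_1 by (auto simp: has_even_order_def)
next
  fix x assume no: "\<forall>x \<in> carrier G. x \<otimes> x = \<one> \<longrightarrow> x = \<one>" and x: "x \<in> carrier G"
  show "\<not> has_even_order G x"
  proof
    assume "has_even_order G x"
    \<comment> \<open>\<open>k > 0\<close> reflects that the order is finite; it makes
      \<open>2 * k\<close> dividing \<open>k\<close> absurd at the end.\<close>
    then obtain k where k: "ord x = 2 * k" "k > 0" by (auto simp: has_even_order_def)
    have "x [^] k \<otimes> x [^] k = \<one>" using x k pow_ord_eq_1[OF x] by (simp add: nat_pow_mult mult_2)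
    then have "x [^] k = \<one>" using no nat_pow_closed[OF x] by blast
    then have "ord x dvd k" using x pow_eq_id by simp
    then show False using k by (auto dest: dvd_imp_le)
  qed
qed

text \<open>A coset is trivial exactly when its representative lies in \<open>P\<close>, and
  doubling acts on representatives; so the absence of involutions in the quotient becomes closure of
  \<open>P\<close> under halving inside \<open>H\<close>.\<close>

lemma rational_quotient_no_even_order_iff:
  assumes H: "subtraction_closed H" and P: "subtraction_closed P" "P \<subseteq> H"
  shows "(\<forall>q \<in> carrier (rational_group\<lparr>carrier := H\<rparr> Mod P).
          \<not> has_even_order (rational_group\<lparr>carrier := H\<rparr> Mod P) q) \<longleftrightarrow>
    (\<forall>x\<in>H. x + x \<in> P \<longrightarrow> x \<in> P)"
proof -
  interpret Q: comm_group rational_group by (rule comm_group_rational_group)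
  let ?H = "rational_group\<lparr>carrier := H\<rparr>"
  interpret H: comm_group ?H
    by (rule group.group_comm_groupI[OF subgroup.subgroup_is_group])
      (use H Q.group_axioms in \<open>simp_all add: subgroup_rational_group_iff, simp add: rational_group_def\<close>)
  have sub: "subgroup P ?H" using assms by (simp add: subgroup_rational_subgroup_iff)
  interpret P: normal P ?H using H.normal_iff_subgroup sub by simp
  interpret F: group "?H Mod P" by (rule P.factorgroup_is_group)
  have op: "x \<otimes>\<^bsub>?H\<^esub> y = x + y" for x y by (simp add: rational_group_def)
  have mem: "P #>\<^bsub>?H\<^esub> x = P \<longleftrightarrow> x \<in> P" if "x \<in> H" for x
    using H.coset_join1[OF _ _ sub] H.coset_join2[OF _ sub] that P by auto
  have carr: "carrier (?H Mod P) = (\<lambda>x. P #>\<^bsub>?H\<^esub> x) ` H"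
    by (auto simp: FactGroup_def RCOSETS_def)
  have sq: "(P #>\<^bsub>?H\<^esub> x) \<otimes>\<^bsub>?H Mod P\<^esub> (P #>\<^bsub>?H\<^esub> x) = P #>\<^bsub>?H\<^esub> (x + x)" if "x \<in> H" for x
    using P.rcos_sum[of x x] that unfolding op by (simp add: FactGroup_def)
  have one: "\<one>\<^bsub>?H Mod P\<^esub> = P" by (simp add: FactGroup_def)
  show ?thesis
    unfolding F.no_even_order_iff one
    unfolding carr ball_simps using subtraction_closedD(4)[OF H] by (metis sq mem)
qed

section \<open>Difference sets that are not subgroups\<close>

text \<open>If \<open>X - X\<close> is not closed under addition, two differences whose sum \<open>h\<close> is not a difference
  split \<open>X\<close> into the points that can be shifted forwards by \<open>d\<^sub>1\<close> and the points that can be shifted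
  backwards; both halves are cosets.\<close>

lemma semiaffine_two_cosets:
  fixes X :: "'a::ab_group_add set"
  assumes semi: "\<And>x y z. x \<in> X \<Longrightarrow> y \<in> X \<Longrightarrow> z \<in> X \<Longrightarrow> x + (y - z) \<in> X \<or> x - (y - z) \<in> X"
    and d: "a \<in> X" "b \<in> X" "a' \<in> X" "b' \<in> X"
    and h: "\<And>x y. x \<in> X \<Longrightarrow> y \<in> X \<Longrightarrow> x - y \<noteq> (a - b) + (a' - b')"
  obtains H x y where "subtraction_closed H" "x \<in> X" "y \<in> X"
    "X = (\<lambda>u. u + x) ` H \<union> (\<lambda>u. u + y) ` H"
proof -
  define d1 d2 where "d1 = a - b" and "d2 = a' - b'"
  define h where "h = d1 + d2"
  have shift1: "x + d1 \<in> X \<or> x - d1 \<in> X" and shift2: "x + d2 \<in> X \<or> x - d2 \<in> X" if "x \<in> X" for x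
    using semi[OF that d(1,2)] semi[OF that d(3,4)] by (auto simp: d1_def d2_def)
  have no: "x \<in> X \<Longrightarrow> y \<in> X \<Longrightarrow> x \<noteq> y + h" for x y
    using h[of x y] unfolding h_def d1_def d2_def by (metis add_diff_cancel_left')
  define A where "A = {x \<in> X. x + d1 \<in> X}"
  have A_iff: "x \<in> A \<longleftrightarrow> x + d2 \<in> X" "x \<in> A \<longleftrightarrow> x - d1 \<notin> X" "x \<in> A \<longleftrightarrow> x - d2 \<notin> X" if "x \<in> X" for x
  proof -
    \<comment> \<open>In each pair the two points differ by \<open>h\<close>, so they cannot both
      lie in \<open>X\<close>. Together with the two shift alternatives, membership in
      \<open>A\<close> then decides all four shifts.\<close>
    have "\<not> (x + d1 \<in> X \<and> x - d2 \<in> X)" "\<not> (x + d2 \<in> X \<and> x - d1 \<in> X)"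
      using no[of "x + d1" "x - d2"] no[of "x + d2" "x - d1"] by (auto simp: h_def algebra_simps)
    then show "x \<in> A \<longleftrightarrow> x + d2 \<in> X" "x \<in> A \<longleftrightarrow> x - d1 \<notin> X" "x \<in> A \<longleftrightarrow> x - d2 \<notin> X"
      using shift1[OF that] shift2[OF that] that unfolding A_def by auto
  qed
  have AX: "x \<in> X" "x + d1 \<in> X" "x + d2 \<in> X" "x - d1 \<notin> X" "x - d2 \<notin> X" if "x \<in> A" for x
    using that A_iff[of x] unfolding A_def by auto
  have bwd: "x - d1 \<in> A" if "x \<in> X" "x \<notin> A" for x
    using A_iff(2)[of x] that by (auto simp: A_def)
  have reflect: "x - (y - x) \<in> A" if x: "x \<in> A" and y: "y \<in> A" for x y
  proof -
    define v where "v = y - x"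
    \<comment> \<open>The other alternative is \<open>x - (d1 - v) = y - d1\<close>, which is
      outside \<open>X\<close> because \<open>y \<in> A\<close>.\<close>
    have u1: "x + (d1 - v) \<in> X"
      using semi[of x "x + d1" y] AX[OF x] AX[OF y] by (auto simp: v_def algebra_simps)
    have "x + (d1 - v) \<notin> A"
    proof
      assume "x + (d1 - v) \<in> A"
      then have hv: "x + d1 - v + d2 \<in> X" and hv': "x + d1 - v \<in> X" using AX(1)[of "x + d1 - v"] AX(3)[of "x + d1 - v"] by (auto simp: add_diff_eq)
      \<comment> \<open>Both alternatives fail: the first point lies \<open>h\<close> beyond
        \<open>x + d1 - v\<close>, and the second is \<open>y - d2\<close>.\<close>
      have "(x + d1) + (h - v) \<in> X \<or> (x + d1) - (h - v) \<in> X"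
        using semi[of "x + d1" "x + d1 - v + d2" x] AX[OF x] hv by (simp add: h_def algebra_simps)
      then show False
      proof
        assume "(x + d1) + (h - v) \<in> X"
        then show False using no[OF _ hv', of "(x + d1) + (h - v)"] by (simp add: algebra_simps)
      next
        assume "(x + d1) - (h - v) \<in> X"
        then show False using AX(5)[OF y] by (simp add: h_def v_def algebra_simps)
      qed
    qed
    from bwd[OF u1 this] show ?thesis by (simp add: v_def algebra_simps)
  qed
  have fwd: "z + (x - y) \<in> A" if A: "x \<in> A" "y \<in> A" "z \<in> A" and X: "z + (x - y) \<in> X" for x y z
  proof (rule ccontr)
    assume "z + (x - y) \<notin> A"
    \<comment> \<open>A point of \<open>X\<close> outside \<open>A\<close> enters \<open>A\<close>
      after a backward shift by \<open>d1\<close>; reflecting the result in \<open>z\<close> allows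
      a further shift by \<open>d2\<close>, which makes \<open>h - (x - y)\<close> a difference of
      points of \<open>X\<close>.\<close>
    from reflect[OF A(3) bwd[OF X this]] have "z - (x - y) + d1 \<in> A" by (simp add: algebra_simps)
    then have hX: "z - (x - y) + d1 + d2 \<in> X" using AX by blast
    \<comment> \<open>Again both alternatives produce a forbidden difference \<open>h\<close>: the
      first with \<open>y\<close>, the second with the reflection of \<open>y\<close> in
      \<open>x\<close>.\<close>
    have "x + (h - (x - y)) \<in> X \<or> x - (h - (x - y)) \<in> X"
      using semi[OF _ hX, of x z] AX[OF A(1)] AX[OF A(3)] by (simp add: h_def algebra_simps)
    then show False
    proof
      assume "x + (h - (x - y)) \<in> X"
      then show False using no[OF _ AX(1)[OF A(2)], of "x + (h - (x - y))"] by (simp add: algebra_simps)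
    next
      assume "x - (h - (x - y)) \<in> X"
      then show False
        using no[OF AX(1)[OF reflect[OF A(1,2)]], of "x - (h - (x - y))"] by (simp add: algebra_simps)
    qed
  qed
  have affine: "z + (x - y) \<in> A" if A: "x \<in> A" "y \<in> A" "z \<in> A" for x y z
  proof -
    consider "z + (x - y) \<in> X" | "z + (y - x) \<in> X"
      using semi[of z x y] AX(1)[OF A(1)] AX(1)[OF A(2)] AX(1)[OF A(3)] by (auto simp: algebra_simps)
    then show ?thesis
    proof cases
      case 1
      then show ?thesis using fwd A by blast
    next
      case 2
      \<comment> \<open>The opposite translate is in \<open>A\<close> by \<open>fwd\<close>, and its
        reflection in \<open>z\<close> is the required point.\<close>
      from reflect[OF A(3) fwd[OF A(2,1,3) this]] show ?thesis by (simp add: algebra_simps)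
    qed
  qed
  obtain x where x: "x \<in> A" using bwd[OF d(1)] by blast
  define H where "H = (\<lambda>y. y - x) ` A"
  have H_iff: "u \<in> H \<longleftrightarrow> u + x \<in> A" for u unfolding H_def by (force simp: image_iff)
  have "subtraction_closed H"
    unfolding subtraction_closed_def H_iff
  proof (intro conjI ballI)
    show "0 + x \<in> A" using x by simp
    fix u v assume "u \<in> H" "v \<in> H"
    then show "u - v + x \<in> A" using affine[of "u + x" "v + x" x] x by (simp add: H_iff algebra_simps)
  qed
  \<comment> \<open>\<open>A\<close> is the coset \<open>H + x\<close>; by \<open>bwd\<close>,
    whatever \<open>X\<close> has outside \<open>A\<close> lies in \<open>A + d1\<close>.\<close>
  moreover have "X = (\<lambda>u. u + x) ` H \<union> (\<lambda>u. u + (x + d1)) ` H"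
  proof (rule Set.set_eqI)
    fix t
    have "t \<in> X \<longleftrightarrow> t \<in> A \<or> t - d1 \<in> A" using bwd[of t] AX(1,2)[of t] AX(2)[of "t - d1"] by auto
    also have "\<dots> \<longleftrightarrow> t - x \<in> H \<or> t - (x + d1) \<in> H" by (simp add: H_iff algebra_simps)
    also have "\<dots> \<longleftrightarrow> t \<in> (\<lambda>u. u + x) ` H \<union> (\<lambda>u. u + (x + d1)) ` H"
      by (force simp: image_iff)
    finally show "t \<in> X \<longleftrightarrow> t \<in> (\<lambda>u. u + x) ` H \<union> (\<lambda>u. u + (x + d1)) ` H" .
  qed
  ultimately show thesis using that[of H x "x + d1"] AX[OF x] by blast
qed

section \<open>Midconvex sets of integers\<close>

text \<open>A midpoint is given as the centre \<open>w\<close> of \<open>w + t\<close> and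
  \<open>w - t\<close>, since halving need not be possible in \<open>H\<close>.\<close>

definition midconvex_in :: "'a::ab_group_add set \<Rightarrow> 'a set \<Rightarrow> bool"
  where "midconvex_in H C \<longleftrightarrow> (\<forall>w\<in>H. \<forall>t\<in>H. w + t \<in> C \<and> w - t \<in> C \<longrightarrow> w \<in> C)"

lemma midconvex_in_UNIV_midpoint:
  assumes "midconvex_in UNIV S" "p \<in> S" "q \<in> S" "p + q = w + w"
  shows "w \<in> S"
proof -
  have "w - (q - w) = p" using assms(4) by (simp add: algebra_simps)
  then have "w + (q - w) \<in> S \<and> w - (q - w) \<in> S" using assms(2,3) by simp
  then show ?thesis using assms(1) unfolding midconvex_in_def by blast
qed

text \<open>Let \<open>t\<close> be the first point of \<open>S\<close> after \<open>u + k\<close>. The gap \<open>t - (u + k)\<close> is odd, as otherwise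
  its midpoint would be in \<open>S\<close>; hence \<open>t - u\<close> is even and its midpoint can only be \<open>u + k\<close>.\<close>

lemma midconvex_int_progression_above:
  fixes S :: "int set"
  assumes mid: "midconvex_in UNIV S" and k: "k > 0" "odd k"
    and gap: "\<And>s s'. s \<in> S \<Longrightarrow> s' \<in> S \<Longrightarrow> s < s' \<Longrightarrow> k \<le> s' - s"
    and "u \<in> S" "u + k \<in> S" "s \<in> S" "u \<le> s"
  shows "k dvd s - u \<and> (\<forall>x. u \<le> x \<and> x \<le> s \<and> k dvd x - u \<longrightarrow> x \<in> S)"
  using assms(5-)
\<comment> \<open>The end \<open>s\<close> stays fixed while the pair \<open>u\<close>,
  \<open>u + k\<close> advances to \<open>u + k\<close>, \<open>u + 2 * k\<close>.\<close>
proof (induction "nat (s - u)" arbitrary: u rule: less_induct)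
  case less
  show ?case
  proof (cases "s \<le> u + k")
    case True
    then have "s = u \<or> s = u + k" using gap[of u s] less.prems k by force
    moreover have "x = u \<or> x = u + k" if x: "u \<le> x" "x \<le> u + k" "k dvd x - u" for x
    proof -
      obtain j where j: "x - u = k * j" using x(3) by (auto simp: dvd_def)
      have "0 \<le> k * j" using j x(1) by linarith
      then have "0 \<le> j" using k by (simp add: zero_le_mult_iff)
      moreover have "k * j \<le> k * 1" using j x(2) by linarith
      then have "j \<le> 1" using k(1) by (simp only: mult_le_cancel_left_pos)
      ultimately have "j = 0 \<or> j = 1" by linarith
      then show ?thesis using j by auto
    qed
    moreover have "x \<le> u + k" if "x \<le> s" for x using that True by simp
    ultimately show ?thesis using less.prems by (metis add_diff_cancel_left' diff_self dvd_0_right dvd_refl)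
  next
    case False
    define v where "v = u + k"
    \<comment> \<open>Integers beyond \<open>v\<close> are counted as \<open>v + m + 1\<close> with
      a natural number \<open>m\<close>, so that \<open>LEAST\<close> applies and \<open>t\<close>
      comes strictly after \<open>v\<close>.\<close>
    define m where "m = (LEAST m. v + int m + 1 \<in> S)"
    have ex: "v + int (nat (s - v - 1)) + 1 \<in> S" using False less.prems by (simp add: v_def)
    define t where "t = v + int m + 1"
    have t: "t \<in> S" "v < t" using LeastI[of "\<lambda>m. v + int m + 1 \<in> S", OF ex] by (auto simp: t_def m_def)
    have least: "t \<le> y" if "y \<in> S" "v < y" for y
    proof -
      have "v + int (nat (y - v - 1)) + 1 \<in> S" using that by simp
      then have "m \<le> nat (y - v - 1)" unfolding m_def by (rule Least_le)
      then show ?thesis using that by (simp add: t_def)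
    qed
    have v: "v \<in> S" using less.prems by (simp add: v_def)
    have "odd (t - v)"
    proof
      assume "even (t - v)"
      then obtain j where j: "t - v = 2 * j" by (elim evenE)
      have "v + j \<in> S" by (rule midconvex_in_UNIV_midpoint[OF mid v t(1)]) (use j in simp)
      then show False using least[of "v + j"] j t by simp
    qed
    then have "even (t - u)" using k by (simp add: v_def)
    then obtain j where j: "t - u = 2 * j" by (elim evenE)
    have uj: "u + j \<in> S" by (rule midconvex_in_UNIV_midpoint[OF mid less.prems(1) t(1)]) (use j in simp)
    have "k \<le> j" using gap[of u "u + j"] uj less.prems j t k by (simp add: v_def)
    moreover have "j \<le> k" using least[OF uj] j t k by (fastforce simp: v_def)
    ultimately have "t = v + k" using j by (simp add: v_def)
    then have IH: "k dvd s - v \<and> (\<forall>x. v \<le> x \<and> x \<le> s \<and> k dvd x - v \<longrightarrow> x \<in> S)"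
      using less.hyps[of v] less.prems v t False k by (simp add: v_def)
    have dv: "k dvd x - u \<longleftrightarrow> k dvd x - v" for x
      unfolding v_def by (metis diff_diff_add dvd_diff_left_iff dvd_refl)
    have "x \<in> S" if "u \<le> x" "x \<le> s" "k dvd x - u" for x
    proof (cases "v \<le> x")
      case True
      then show ?thesis using IH that dv by blast
    next
      case False
      then have "x - u = 0" using that k zdvd_imp_le[of k "x - u"] by (fastforce simp: v_def)
      then show ?thesis using less.prems by simp
    qed
    then show ?thesis using IH dv by blast
  qed
qed

text \<open>Take for \<open>k\<close> the least positive difference, attained between
  \<open>u\<close> and \<open>u + k\<close>. It is odd, as the midpoint of an even shortest gap
  would yield a shorter one. The one-sided result runs upwards from \<open>u\<close> and, after a
  reflection, downwards from \<open>u + k\<close>.\<close>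

lemma midconvex_int_progression:
  fixes S :: "int set"
  assumes mid: "midconvex_in UNIV S" and "p \<in> S" "q \<in> S" "p \<noteq> q"
  obtains k where "odd k" "\<exists>u\<in>S. u + k \<in> S"
    "\<And>s s'. s \<in> S \<Longrightarrow> s' \<in> S \<Longrightarrow> k dvd s' - s"
    "\<And>s s' x. s \<in> S \<Longrightarrow> s' \<in> S \<Longrightarrow> s \<le> x \<Longrightarrow> x \<le> s' \<Longrightarrow> k dvd x - s \<Longrightarrow> x \<in> S"
proof -
  define Q where "Q = (\<lambda>n. n > 0 \<and> (\<exists>u\<in>S. u + int n \<in> S))"
  have "Q (nat \<bar>p - q\<bar>)"
    using assms unfolding Q_def by (auto simp: abs_if intro!: bexI[of _ "min p q"] split: if_splits)
  then have QL: "Q (Least Q)" and least: "\<And>n. Q n \<Longrightarrow> Least Q \<le> n" by (auto intro: LeastI Least_le)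
  define k where "k = int (Least Q)"
  obtain u where u: "u \<in> S" "u + k \<in> S" and k: "k > 0" using QL by (auto simp: Q_def k_def)
  have gap: "k \<le> s' - s" if "s \<in> S" "s' \<in> S" "s < s'" for s s'
    using least[of "nat (s' - s)"] that unfolding Q_def k_def by force
  have "odd k"
  proof
    assume "even k"
    then obtain j where j: "k = 2 * j" by (elim evenE)
    have "u + j \<in> S" by (rule midconvex_in_UNIV_midpoint[OF mid u]) (use j in simp)
    then show False using gap[of u "u + j"] u j k by simp
  qed
  have above: "k dvd s - u \<and> (\<forall>x. u \<le> x \<and> x \<le> s \<and> k dvd x - u \<longrightarrow> x \<in> S)"
    if "s \<in> S" "u \<le> s" for s
    by (rule midconvex_int_progression_above[OF mid k \<open>odd k\<close> _ u that]) (rule gap)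
  \<comment> \<open>In the reflected set \<open>- (u + k)\<close> and \<open>- u\<close> play the
    roles of \<open>u\<close> and \<open>u + k\<close>.\<close>
  have mid': "midconvex_in UNIV (uminus ` S)"
    unfolding midconvex_in_def
  proof (intro ballI impI)
    fix w t :: int assume "w + t \<in> uminus ` S \<and> w - t \<in> uminus ` S"
    then obtain p q where "p \<in> S" "q \<in> S" "w + t = - p" "w - t = - q" by blast
    then have "- w \<in> S" by (auto intro!: midconvex_in_UNIV_midpoint[OF mid \<open>p \<in> S\<close> \<open>q \<in> S\<close>])
    then show "w \<in> uminus ` S" by (rule image_eqI[rotated]) simp
  qed
  have below: "k dvd (u + k) - s \<and> (\<forall>x. s \<le> x \<and> x \<le> u + k \<and> k dvd u + k - x \<longrightarrow> x \<in> S)"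
    if "s \<in> S" "s \<le> u + k" for s
  proof -
    have "k dvd - s - - (u + k) \<and>
      (\<forall>x. - (u + k) \<le> x \<and> x \<le> - s \<and> k dvd x - - (u + k) \<longrightarrow> x \<in> uminus ` S)"
    proof (rule midconvex_int_progression_above[OF mid' k \<open>odd k\<close>])
      fix s s' assume "s \<in> uminus ` S" "s' \<in> uminus ` S" "s < s'"
      then show "k \<le> s' - s" using gap[of "- s'" "- s"] by auto
    next
      show "- (u + k) + k \<in> uminus ` S" by (rule image_eqI[OF _ u(1)]) simp
      show "- (u + k) \<in> uminus ` S" "- s \<in> uminus ` S" "- (u + k) \<le> - s"
        using u that by (blast, blast, simp)
    qed
    then have dvd: "k dvd - s - - (u + k)"
      and all: "\<And>x. - (u + k) \<le> x \<Longrightarrow> x \<le> - s \<Longrightarrow> k dvd x - - (u + k) \<Longrightarrow> x \<in> uminus ` S" by blast+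
    have "x \<in> S" if "s \<le> x" "x \<le> u + k" "k dvd u + k - x" for x
      using all[of "- x"] that by (auto simp: algebra_simps)
    then show ?thesis using dvd by (simp add: algebra_simps)
  qed
  have cong: "k dvd s - u" if "s \<in> S" for s
  proof (cases "u \<le> s")
    case True
    then show ?thesis using above[OF that] by blast
  next
    case False
    then have "k dvd k - (s - u)" using below[OF that] k by (simp add: algebra_simps)
    then show ?thesis by (simp add: dvd_diff_right_iff)
  qed
  show thesis
  proof
    show "odd k" by fact
    show "\<exists>u\<in>S. u + k \<in> S" using u by blast
    show "k dvd s' - s" if "s \<in> S" "s' \<in> S" for s s'
      using dvd_diff[OF cong[OF that(2)] cong[OF that(1)]] by simp
    fix s s' x assume s: "s \<in> S" "s' \<in> S" "s \<le> x" "x \<le> s'" "k dvd x - s"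
    have x: "k dvd x - u" using dvd_add[OF s(5) cong[OF s(1)]] by simp
    show "x \<in> S"
    proof (cases "u \<le> x")
      case True
      then show ?thesis using above[of s'] s x by auto
    next
      case False
      have "k dvd u + k - x" using dvd_diff[OF dvd_refl x] by (simp add: algebra_simps)
      then show ?thesis using below[of s] s False k by auto
    qed
  qed
qed

section \<open>Midconvex sets of rationals\<close>

text \<open>By induction on \<open>F\<close>: the generator found so far and the new element are
  replaced by their greatest common divisor as fractions, which Bezout's identity places in
  \<open>H\<close>.\<close>

lemma finite_subset_cyclic_rat:
  fixes H F :: "rat set"
  assumes H: "subtraction_closed H" and "finite F" "F \<subseteq> H"
  obtains d where "d \<in> H" "d \<ge> 0" "\<And>x. x \<in> F \<Longrightarrow> \<exists>n. x = of_int n * d"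
proof -
  have "\<exists>d\<in>H. d \<ge> 0 \<and> (\<forall>x\<in>F. \<exists>n. x = of_int n * d)"
    using assms(2,3)
  proof (induction F)
    case empty
    then show ?case using subtraction_closedD(1)[OF H] by auto
  next
    case (insert a F)
    then obtain b where b: "b \<in> H" "b \<ge> 0" "\<And>x. x \<in> F \<Longrightarrow> \<exists>n. x = of_int n * b" by auto
    obtain p q where pq: "a = of_int p / of_int q" "q > 0" by (metis quotient_of_div quotient_of_denom_pos surj_pair)
    obtain r s where rs: "b = of_int r / of_int s" "s > 0" by (metis quotient_of_div quotient_of_denom_pos surj_pair)
    \<comment> \<open>Over the common denominator \<open>q * s\<close> the numerators of
      \<open>a\<close> and \<open>b\<close> are \<open>p * s\<close> and
      \<open>r * q\<close>.\<close>
    define g where "g = gcd (p * s) (r * q)"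
    define d :: rat where "d = of_int g / of_int (q * s)"
    obtain m n where "m * (p * s) + n * (r * q) = g" unfolding g_def by (metis bezout_int)
    then have "d = of_int m * a + of_int n * b"
      using pq rs unfolding d_def pq rs by (simp add: field_simps flip: of_int_mult of_int_add)
    then have "d \<in> H"
      using insert.prems b(1) subtraction_closedD(4)[OF H] subtraction_closed_of_int[OF H] by auto
    moreover have "d \<ge> 0" using pq rs by (simp add: d_def g_def)
    moreover have "\<exists>n. a = of_int n * d"
    proof -
      obtain j where "p * s = g * j" unfolding g_def by (metis dvd_def gcd_dvd1)
      then have "a = of_int j * d" using pq rs unfolding d_def pq by (simp add: field_simps flip: of_int_mult)
      then show ?thesis by blast
    qed
    moreover have "\<exists>n. b = of_int n * d"
    proof -
      obtain j where "r * q = g * j" unfolding g_def by (metis dvd_def gcd_dvd2)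
      then have "b = of_int j * d" using pq rs unfolding d_def rs by (simp add: field_simps flip: of_int_mult)
      then show ?thesis by blast
    qed
    moreover have "\<exists>n. x = of_int n * d" if x: "x \<in> F" for x
    proof -
      obtain i j where "x = of_int i * b" "b = of_int j * d"
        using b(3)[OF x] \<open>\<exists>n. b = of_int n * d\<close> by blast
      then have "x = of_int (i * j) * d" by simp
      then show ?thesis by blast
    qed
    ultimately show ?case by blast
  qed
  then show thesis using that by blast
qed

text \<open>The step \<open>e\<close> may be \<open>0\<close>; this happens when \<open>C\<close> has at most one point in the cyclic group
  spanned by \<open>F\<close>.\<close>

lemma midconvex_rat_progression:
  fixes H C F :: "rat set"
  assumes H: "subtraction_closed H" and C: "C \<subseteq> H" "C \<noteq> {}" "midconvex_in H C"
    and F: "finite F" "F \<subseteq> H"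
  obtains e where "\<exists>c\<in>C. \<exists>c'\<in>C. e = c' - c"
    "\<And>s s'. s \<in> C \<inter> F \<Longrightarrow> s' \<in> C \<inter> F \<Longrightarrow> \<exists>n. s' - s = of_int n * e"
    "\<And>s s' x n. s \<in> C \<inter> F \<Longrightarrow> s' \<in> C \<inter> F \<Longrightarrow> x \<in> F \<Longrightarrow> s \<le> x \<Longrightarrow> x \<le> s' \<Longrightarrow>
      x - s = of_int n * e \<Longrightarrow> x \<in> C"
    "\<And>x n. x \<in> F \<Longrightarrow> x + x = of_int n * e \<Longrightarrow> \<exists>m. x = of_int m * e"
proof (cases "\<exists>s\<in>C \<inter> F. \<exists>s'\<in>C \<inter> F. s \<noteq> s'")
  case False
  show thesis
  proof (rule that[of 0])
    show "\<exists>c\<in>C. \<exists>c'\<in>C. 0 = c' - c" using C(2) by auto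
  qed (use False in auto)
next
  case True
  then obtain s0 s1 where s01: "s0 \<in> C \<inter> F" "s1 \<in> C \<inter> F" "s0 \<noteq> s1" by blast
  obtain d where d: "d \<in> H" "d \<ge> 0" "\<And>x. x \<in> F \<Longrightarrow> \<exists>n. x = of_int n * d"
    using finite_subset_cyclic_rat[OF H F] by metis
  \<comment> \<open>\<open>S\<close> holds the coordinates, along the generator \<open>d\<close>, of
    the points of \<open>C\<close>; this reduces the claim to integers.\<close>
  define S where "S = {n. of_int n * d \<in> C}"
  have inS: "\<exists>n\<in>S. s = of_int n * d" if "s \<in> C \<inter> F" for s
    using that d(3)[of s] by (auto simp: S_def)
  obtain p q where pq: "p \<in> S" "q \<in> S" "s0 = of_int p * d" "s1 = of_int q * d"
    using inS s01 by blast
  then have "p \<noteq> q" "d \<noteq> 0" using s01 by auto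
  then have pos: "d > 0" using d(2) by simp
  have mid: "midconvex_in UNIV S"
    using C(3) subtraction_closed_of_int[OF H d(1)] unfolding midconvex_in_def S_def
    by (auto simp: algebra_simps)
  obtain k where k: "odd k" "\<exists>u\<in>S. u + k \<in> S"
    "\<And>s s'. s \<in> S \<Longrightarrow> s' \<in> S \<Longrightarrow> k dvd s' - s"
    "\<And>s s' x. s \<in> S \<Longrightarrow> s' \<in> S \<Longrightarrow> s \<le> x \<Longrightarrow> x \<le> s' \<Longrightarrow> k dvd x - s \<Longrightarrow> x \<in> S"
    using midconvex_int_progression[OF mid pq(1,2) \<open>p \<noteq> q\<close>] by blast
  define e where "e = of_int k * d"
  have mult_iff: "of_int i * d = of_int n * e \<longleftrightarrow> i = n * k" for i n
  proof -
    have "of_int i * d = of_int n * e \<longleftrightarrow> of_int i * d = of_int (n * k) * d" by (simp add: e_def)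
    also have "\<dots> \<longleftrightarrow> i = n * k" using \<open>d \<noteq> 0\<close> by (simp del: of_int_mult)
    finally show ?thesis .
  qed
  show thesis
  proof (rule that[of e])
    show "\<exists>c\<in>C. \<exists>c'\<in>C. e = c' - c"
    proof -
      obtain u where "u \<in> S" "u + k \<in> S" using k(2) by blast
      then show ?thesis
        by (intro bexI[of _ "of_int u * d"] bexI[of _ "of_int (u + k) * d"])
          (auto simp: S_def e_def algebra_simps)
    qed
  next
    fix s s' assume "s \<in> C \<inter> F" "s' \<in> C \<inter> F"
    then obtain i j where ij: "i \<in> S" "j \<in> S" "s = of_int i * d" "s' = of_int j * d" using inS by metis
    obtain n where "j - i = n * k" using k(3)[OF ij(1,2)] by (auto simp: dvd_def mult.commute)
    then show "\<exists>n. s' - s = of_int n * e" using ij mult_iff[of "j - i" n] by (auto simp: algebra_simps)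
  next
    fix s s' x n assume s: "s \<in> C \<inter> F" "s' \<in> C \<inter> F" and x: "x \<in> F" "s \<le> x" "x \<le> s'"
      and n: "x - s = of_int n * e"
    obtain i j where ij: "i \<in> S" "j \<in> S" "s = of_int i * d" "s' = of_int j * d" using inS s by metis
    obtain m where m: "x = of_int m * d" using d(3) x by blast
    have "i \<le> m" "m \<le> j" using x ij m pos by auto
    moreover have "k dvd m - i" using n mult_iff[of "m - i" n] ij m by (simp add: algebra_simps)
    ultimately have "m \<in> S" using k(4) ij by blast
    then show "x \<in> C" by (simp add: S_def m)
  next
    fix x n assume x: "x \<in> F" and n: "x + x = of_int n * e"
    obtain m where m: "x = of_int m * d" using d(3) x by blast
    then have "of_int (2 * m) * d = of_int n * e" using n by (simp add: algebra_simps)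
    then have "2 * m = n * k" unfolding mult_iff .
    \<comment> \<open>Oddness of the step \<open>k\<close> is what permits halving.\<close>
    then have "even n" using k(1) by (metis dvd_triv_left even_mult_iff)
    then obtain j where "n = 2 * j" by (elim evenE)
    then have "m = j * k" using \<open>2 * m = n * k\<close> by simp
    then show "\<exists>m. x = of_int m * e" using m mult_iff by blast
  qed
qed

text \<open>Each claim involves finitely many points, hence one progression. Its step
  \<open>e\<close> is itself a difference of two points of \<open>C\<close>, possibly outside the
  chosen finite set, so all multiples of \<open>e\<close> belong to \<open>P\<close>.\<close>

lemma midconvex_rat:
  fixes H C :: "rat set"
  assumes H: "subtraction_closed H" and C: "C \<subseteq> H" "c0 \<in> C" "midconvex_in H C"
  obtains P where "subtraction_closed P" "P \<subseteq> H" "\<And>x. x \<in> H \<Longrightarrow> x + x \<in> P \<Longrightarrow> x \<in> P"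
    "C = {x. x - c0 \<in> P \<and> (\<exists>s\<in>C. \<exists>s'\<in>C. s \<le> x \<and> x \<le> s')}"
proof -
  \<comment> \<open>Multiples of single differences already form a group: any two differences are
    multiples of a common one.\<close>
  define P where "P = {x. \<exists>c\<in>C. \<exists>c'\<in>C. \<exists>n. x = of_int n * (c' - c)}"
  have P_I: "of_int n * e \<in> P" if "\<exists>c\<in>C. \<exists>c'\<in>C. e = c' - c" for n e
    using that by (auto simp: P_def)
  have PH: "P \<subseteq> H"
    using C(1) unfolding P_def
    by (blast intro: subtraction_closedD(2)[OF H] subtraction_closed_of_int[OF H])
  note prog = midconvex_rat_progression[OF H C(1) _ C(3)]
  have ne: "C \<noteq> {}" using C by auto
  have "subtraction_closed P"
    unfolding subtraction_closed_def
  proof (intro conjI ballI)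
    show "0 \<in> P" using P_I[of 0 0] C by auto
    fix x y assume "x \<in> P" "y \<in> P"
    then obtain c c' n b b' m where *: "c \<in> C" "c' \<in> C" "x = of_int n * (c' - c)"
      "b \<in> C" "b' \<in> C" "y = of_int m * (b' - b)" unfolding P_def by blast
    then have F: "finite {c, c', b, b'}" "{c, c', b, b'} \<subseteq> H" using C by auto
    obtain e where e: "\<exists>c\<in>C. \<exists>c'\<in>C. e = c' - c"
      "\<And>s s'. s \<in> C \<inter> {c, c', b, b'} \<Longrightarrow> s' \<in> C \<inter> {c, c', b, b'} \<Longrightarrow> \<exists>n. s' - s = of_int n * e"
      by (rule prog[OF ne F]) (use that in blast)
    obtain i j where "c' - c = of_int i * e" "b' - b = of_int j * e"
      using e(2)[of c c'] e(2)[of b b'] * by auto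
    then have "x - y = of_int (n * i - m * j) * e" using * by (simp add: algebra_simps)
    then show "x - y \<in> P" using P_I[OF e(1)] by metis
  qed
  moreover have "x \<in> P" if x: "x \<in> H" "x + x \<in> P" for x
  proof -
    obtain c c' n where *: "c \<in> C" "c' \<in> C" "x + x = of_int n * (c' - c)" using x unfolding P_def by blast
    then have F: "finite {x, c, c'}" "{x, c, c'} \<subseteq> H" using C x by auto
    obtain e where e: "\<exists>c\<in>C. \<exists>c'\<in>C. e = c' - c"
      "\<And>s s'. s \<in> C \<inter> {x, c, c'} \<Longrightarrow> s' \<in> C \<inter> {x, c, c'} \<Longrightarrow> \<exists>n. s' - s = of_int n * e"
      "\<And>y n. y \<in> {x, c, c'} \<Longrightarrow> y + y = of_int n * e \<Longrightarrow> \<exists>m. y = of_int m * e"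
      by (rule prog[OF ne F]) (use that in blast)
    obtain i where "c' - c = of_int i * e" using e(2)[of c c'] * by auto
    then have "x + x = of_int (n * i) * e" using * by simp
    then show ?thesis using e(3)[of x] P_I[OF e(1)] by blast
  qed
  moreover have "C = {x. x - c0 \<in> P \<and> (\<exists>s\<in>C. \<exists>s'\<in>C. s \<le> x \<and> x \<le> s')}"
  proof (intro equalityI subsetI)
    fix x assume "x \<in> C"
    then show "x \<in> {x. x - c0 \<in> P \<and> (\<exists>s\<in>C. \<exists>s'\<in>C. s \<le> x \<and> x \<le> s')}"
      using P_I[of "x - c0" 1] C by auto
  next
    fix x assume "x \<in> {x. x - c0 \<in> P \<and> (\<exists>s\<in>C. \<exists>s'\<in>C. s \<le> x \<and> x \<le> s')}"
    then obtain s s' where xP: "x - c0 \<in> P" and s: "s \<in> C" "s' \<in> C" "s \<le> x" "x \<le> s'" by blast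
    obtain c c' n where *: "c \<in> C" "c' \<in> C" "x - c0 = of_int n * (c' - c)" using xP unfolding P_def by blast
    have "x \<in> H" using subtraction_closedD(4)[OF H, of "x - c0" c0] xP PH C by auto
    \<comment> \<open>The point, the base point, the two bounds around \<open>x\<close>, and the
      difference witnessing \<open>x - c0 \<in> P\<close>.\<close>
    let ?F = "{x, c0, s, s', c, c'}"
    have F: "finite ?F" "?F \<subseteq> H" using C \<open>x \<in> H\<close> s * by auto
    obtain e where e: "\<And>s s'. s \<in> C \<inter> ?F \<Longrightarrow> s' \<in> C \<inter> ?F \<Longrightarrow> \<exists>n. s' - s = of_int n * e"
      "\<And>s s' x n. s \<in> C \<inter> ?F \<Longrightarrow> s' \<in> C \<inter> ?F \<Longrightarrow> x \<in> ?F \<Longrightarrow> s \<le> x \<Longrightarrow> x \<le> s' \<Longrightarrow>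
      x - s = of_int n * e \<Longrightarrow> x \<in> C"
      by (rule prog[OF ne F]) (use that in blast)
    obtain i j where "c' - c = of_int i * e" "c0 - s = of_int j * e"
      using e(1)[of c c'] e(1)[of s c0] * s C by auto
    then have "x - s = of_int (n * i + j) * e" using * by (simp add: algebra_simps)
    then show "x \<in> C" using e(2)[of s s' x "n * i + j"] s by auto
  qed
  ultimately show thesis using that PH by blast
qed

section \<open>Both kinds of sets are semiaffine\<close>

text \<open>Two of the three points share a coset by the pigeonhole principle. If these are
  \<open>y\<close>, \<open>z\<close> or \<open>x\<close>, \<open>z\<close>, then
  \<open>x + (y - z)\<close> lies in the coset of the remaining point; if they are \<open>x\<close>,
  \<open>y\<close>, then \<open>x - (y - z)\<close> does.\<close>

lemma semiaffine_two_cosets_converse: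
  fixes H :: "'a::ab_group_add set"
  assumes H: "subtraction_closed H" and X: "X = (\<lambda>u. u + a) ` H \<union> (\<lambda>u. u + b) ` H"
    and xyz: "x \<in> X" "y \<in> X" "z \<in> X"
  shows "x + (y - z) \<in> X \<or> x - (y - z) \<in> X"
proof -
  have X_iff: "t \<in> X \<longleftrightarrow> t - a \<in> H \<or> t - b \<in> H" for t unfolding X by (force simp: image_iff)
  have *: "u + v - w \<in> H" if "u \<in> H" "v \<in> H" "w \<in> H" for u v w
    using that subtraction_closedD[OF H] by simp
  have eq: "x + (y - z) - c = (x - c) + (y - d) - (z - d)"
    "x + (y - z) - c = (x - d) + (y - c) - (z - d)"
    "x - (y - z) - c = (x - d) + (z - c) - (y - d)" for c d by (simp_all add: algebra_simps)
  show ?thesis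
    using xyz unfolding X_iff by (metis * eq)
qed

text \<open>If both points were missing, \<open>w + e\<close> and \<open>w - e\<close> would lie in
  \<open>P \<inter> C\<close>. Their sum is \<open>w + w\<close>, so halving puts \<open>w\<close>
  into \<open>P\<close>, and order-convexity puts it into \<open>C\<close>.\<close>

lemma semiaffine_complement:
  fixes H P C X :: "rat set"
  assumes H: "subtraction_closed H" and P: "subtraction_closed P"
    and tors: "\<And>x. x \<in> H \<Longrightarrow> x + x \<in> P \<Longrightarrow> x \<in> P" and C: "order_convex C"
    and X: "X = (\<lambda>u. u + g) ` (H - P \<inter> C)" and xyz: "x \<in> X" "y \<in> X" "z \<in> X"
  shows "x + (y - z) \<in> X \<or> x - (y - z) \<in> X"
proof (rule ccontr)
  assume no: "\<not> ?thesis"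
  have X_iff: "t \<in> X \<longleftrightarrow> t - g \<in> H \<and> t - g \<notin> P \<inter> C" for t unfolding X by (force simp: image_iff)
  define w e where "w = x - g" and "e = (y - g) - (z - g)"
  have wH: "w \<in> H" "w \<notin> P \<inter> C" and eH: "e \<in> H"
    using xyz subtraction_closedD(2)[OF H] unfolding X_iff w_def e_def by blast+
  have "x + (y - z) - g = w + e" "x - (y - z) - g = w - e" by (simp_all add: w_def e_def)
  then have PC: "w + e \<in> P" "w - e \<in> P" "w + e \<in> C" "w - e \<in> C"
    using no subtraction_closedD[OF H] wH eH unfolding X_iff by auto
  have "w + w \<in> P" using subtraction_closedD(4)[OF P PC(1,2)] by simp
  then have "w \<in> P" using tors wH by blast
  moreover have "w \<in> C"
  proof (cases "e \<ge> 0")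
    case True
    then have "w - e \<le> w + e" "w \<in> {w - e..w + e}" by auto
    then show ?thesis using C PC unfolding order_convex_def by blast
  next
    case False
    then have "w + e \<le> w - e" "w \<in> {w + e..w - e}" by auto
    then show ?thesis using C PC unfolding order_convex_def by blast
  qed
  ultimately show False using wH by blast
qed

section \<open>The structure of semiaffine sets of rationals\<close>

lemma semiaffine_rat_cases [consumes 3, case_names two_cosets complement]:
  fixes G X :: "rat set"
  assumes G: "subtraction_closed G" and "X \<subseteq> G"
    and semiaffine: "\<forall>x\<in>X. \<forall>y\<in>X. \<forall>z\<in>X. x + (y - z) \<in> X \<or> x - (y - z) \<in> X"
  obtains H a b where "subtraction_closed H" "H \<subseteq> G" "a \<in> X" "b \<in> X"
      "X = (\<lambda>u. u + a) ` H \<union> (\<lambda>u. u + b) ` H"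
    | H P C g where "g \<in> G" "order_convex C" "subtraction_closed H" "H \<subseteq> G"
      "subtraction_closed P" "P \<subseteq> H" "\<forall>x\<in>H. x + x \<in> P \<longrightarrow> x \<in> P"
      "X = (\<lambda>u. u + g) ` (H - P \<inter> C)"
proof (cases "X = {}")
  case True
  \<comment> \<open>The empty set arises by removing all of \<open>G\<close> from
    \<open>G\<close>.\<close>
  show thesis
    by (rule that(2)[of 0 UNIV G G]) (use G True subtraction_closedD[OF G] in \<open>auto simp: order_convex_def\<close>)
next
  case False
  have semi: "x + (y - z) \<in> X \<or> x - (y - z) \<in> X" if "x \<in> X" "y \<in> X" "z \<in> X" for x y z
    using semiaffine that by blast
  obtain x0 where x0: "x0 \<in> X" using False by blast
  define D where "D = {x - y | x y. x \<in> X \<and> y \<in> X}"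
  have DI: "x - y \<in> D" if "x \<in> X" "y \<in> X" for x y using that by (auto simp: D_def)
  have DG: "D \<subseteq> G" using \<open>X \<subseteq> G\<close> subtraction_closedD(2)[OF G] by (auto simp: D_def)
  \<comment> \<open>\<open>D\<close> contains \<open>0\<close> and is symmetric, so closure under
    addition alone decides whether it is a subgroup.\<close>
  show thesis
  proof (cases "\<forall>x\<in>D. \<forall>y\<in>D. x + y \<in> D")
    case False
    then obtain a b a' b' where d: "a \<in> X" "b \<in> X" "a' \<in> X" "b' \<in> X" "(a - b) + (a' - b') \<notin> D"
      by (auto simp: D_def)
    then have ne: "x - y \<noteq> (a - b) + (a' - b')" if "x \<in> X" "y \<in> X" for x y
      using DI[OF that] by metis
    obtain H x y where H: "subtraction_closed H" "x \<in> X" "y \<in> X"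
      "X = (\<lambda>u. u + x) ` H \<union> (\<lambda>u. u + y) ` H"
      using semiaffine_two_cosets[OF semi d(1-4) ne] by blast
    have "H \<subseteq> G"
    proof
      fix u assume "u \<in> H"
      then have "u + x \<in> X" using H(4) by blast
      then show "u \<in> G" using subtraction_closedD(2)[OF G, of "u + x" x] H(2) \<open>X \<subseteq> G\<close> by auto
    qed
    then show thesis using that(1) H by blast
  next
    case True
    have neg: "- x \<in> D" if "x \<in> D" for x
      using that DI by (auto simp: D_def)
    have D: "subtraction_closed D"
      unfolding subtraction_closed_def
    proof (intro conjI ballI)
      show "0 \<in> D" using DI[OF x0 x0] by simp
      show "x - y \<in> D" if "x \<in> D" "y \<in> D" for x y
        using True that(1) neg[OF that(2)] by (metis add_uminus_conv_diff)
    qed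
    \<comment> \<open>The holes of \<open>X\<close> in the coset \<open>D + x0\<close>, moved back
      into \<open>D\<close>.\<close>
    define C where "C = {u \<in> D. u + x0 \<notin> X}"
    have X: "X = (\<lambda>u. u + x0) ` (D - C)"
    proof (intro equalityI subsetI)
      fix x assume "x \<in> X"
      then show "x \<in> (\<lambda>u. u + x0) ` (D - C)"
        by (intro image_eqI[of _ _ "x - x0"]) (auto simp: C_def DI x0)
    qed (auto simp: C_def)
    show thesis
    proof (cases "C = {}")
      case True
      \<comment> \<open>Without holes, \<open>X\<close> is the full coset \<open>D + x0\<close>; the
        pair \<open>P = D\<close> and the empty order-convex set describes it.\<close>
      show thesis
        by (rule that(2)[of x0 "{}" D D])
          (use X True D DG x0 \<open>X \<subseteq> G\<close> in \<open>auto simp: order_convex_def\<close>)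
    next
      case False
      then obtain c0 where c0: "c0 \<in> C" by blast
      have "midconvex_in D C"
        unfolding midconvex_in_def
      proof (intro ballI impI, rule ccontr)
        fix w t assume w: "w \<in> D" "w \<notin> C" and t: "t \<in> D" "w + t \<in> C \<and> w - t \<in> C"
        obtain y z where "t = y - z" "y \<in> X" "z \<in> X" using t(1) by (auto simp: D_def)
        then have "w + x0 + t \<in> X \<or> w + x0 - t \<in> X" using semi[of "w + x0" y z] w by (auto simp: C_def)
        then show False using t by (auto simp: C_def algebra_simps)
      qed
      moreover have "C \<subseteq> D" by (auto simp: C_def)
      ultimately obtain P where P: "subtraction_closed P" "P \<subseteq> D" "\<And>x. x \<in> D \<Longrightarrow> x + x \<in> P \<Longrightarrow> x \<in> P"
        "C = {x. x - c0 \<in> P \<and> (\<exists>s\<in>C. \<exists>s'\<in>C. s \<le> x \<and> x \<le> s')}"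
        using midconvex_rat[OF D _ c0] by blast
      \<comment> \<open>The order-convex hull of \<open>C\<close>, translated by
        \<open>- c0\<close>. This turns the coset of \<open>P\<close> containing \<open>C\<close>
        into \<open>P\<close> itself and leaves \<open>D\<close> in place, while the final
        translation becomes \<open>c0 + x0\<close>.\<close>
      define C' where "C' = {u. \<exists>s\<in>C. \<exists>s'\<in>C. s \<le> u + c0 \<and> u + c0 \<le> s'}"
      have c0D: "c0 \<in> D" using c0 by (simp add: C_def)
      have C_iff: "u + c0 \<in> C \<longleftrightarrow> u \<in> P \<inter> C'" for u
        by (subst P(4)) (simp add: C'_def)
      have D_iff: "u + c0 \<in> D \<longleftrightarrow> u \<in> D" for u
        using subtraction_closedD(4)[OF D, of u c0] subtraction_closedD(2)[OF D, of "u + c0" c0] c0D by auto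
      have "X = (\<lambda>u. u + (c0 + x0)) ` (D - P \<inter> C')"
      proof (intro equalityI subsetI)
        fix x assume "x \<in> X"
        then obtain u where u: "u \<in> D - C" "x = u + x0" unfolding X by blast
        then have "u - c0 \<in> D - P \<inter> C'" using C_iff[of "u - c0"] D_iff[of "u - c0"] by simp
        then show "x \<in> (\<lambda>u. u + (c0 + x0)) ` (D - P \<inter> C')"
          by (rule image_eqI[rotated]) (simp add: u)
      next
        fix x assume "x \<in> (\<lambda>u. u + (c0 + x0)) ` (D - P \<inter> C')"
        then obtain u where u: "u \<in> D - P \<inter> C'" "x = u + (c0 + x0)" by blast
        then have "u + c0 \<in> D - C" using C_iff D_iff by blast
        then show "x \<in> X" unfolding X by (rule image_eqI[rotated]) (simp add: u)
      qed
      moreover have "c0 + x0 \<in> G"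
        using subtraction_closedD(4)[OF G] c0D DG x0 \<open>X \<subseteq> G\<close> by blast
      moreover have "order_convex C'"
        unfolding order_convex_def C'_def by (auto intro: order_trans add_right_mono) (meson add_right_mono order_trans)+
      ultimately show thesis using that(2)[of "c0 + x0" C' D P] D DG P by blast
    qed
  qed
qed

theorem corollary2:
  fixes G X :: "rat set"
  assumes "subgroup G rational_group"
    and "X \<subseteq> G"
  shows "semiaffine (rational_group\<lparr>carrier := G\<rparr>) X \<longleftrightarrow>
    (\<exists>H a b. subgroup H (rational_group\<lparr>carrier := G\<rparr>) \<and> a \<in> X \<and> b \<in> X \<and>
       X = (\<lambda>u. u + a) ` H \<union> (\<lambda>u. u + b) ` H) \<or>
    (\<exists>H P C g. g \<in> G \<and> order_convex C \<and>
       subgroup H (rational_group\<lparr>carrier := G\<rparr>) \<and>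
       subgroup P (rational_group\<lparr>carrier := G\<rparr>) \<and> P \<subseteq> H \<and>
       (\<forall>q \<in> carrier (rational_group\<lparr>carrier := H\<rparr> Mod P).
          \<not> has_even_order (rational_group\<lparr>carrier := H\<rparr> Mod P) q) \<and>
       X = (\<lambda>u. u + g) ` (H - P \<inter> C))"
    (is "?L \<longleftrightarrow> ?two \<or> ?complement")
proof -
  have G: "subtraction_closed G" using assms(1) by (simp add: subgroup_rational_group_iff)
  note semi_iff = semiaffine_rational_iff[OF G assms(2)]
  note sub_iff = subgroup_rational_subgroup_iff[OF G]
  show ?thesis
  proof
    assume ?L
    with semi_iff have "\<forall>x\<in>X. \<forall>y\<in>X. \<forall>z\<in>X. x + (y - z) \<in> X \<or> x - (y - z) \<in> X"
      by blast
    from G assms(2) this show "?two \<or> ?complement"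
    proof (cases rule: semiaffine_rat_cases)
      case (two_cosets H a b)
      then have ?two unfolding sub_iff by blast
      then show ?thesis ..
    next
      case (complement H P C g)
      then have "subgroup H (rational_group\<lparr>carrier := G\<rparr>)" "subgroup P (rational_group\<lparr>carrier := G\<rparr>)"
        using sub_iff by auto
      moreover have "\<forall>q \<in> carrier (rational_group\<lparr>carrier := H\<rparr> Mod P).
          \<not> has_even_order (rational_group\<lparr>carrier := H\<rparr> Mod P) q"
        using complement by (simp only: rational_quotient_no_even_order_iff)
      ultimately show ?thesis using complement by blast
    qed
  next
    assume "?two \<or> ?complement"
    then show ?L
    proof
      assume ?two
      then obtain H a b where H: "subtraction_closed H"
        and X: "X = (\<lambda>u. u + a) ` H \<union> (\<lambda>u. u + b) ` H" using sub_iff by blast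
      show ?L unfolding semi_iff using semiaffine_two_cosets_converse[OF H X] by blast
    next
      assume ?complement
      then obtain H P C g where C: "order_convex C" and H: "subtraction_closed H"
        and P: "subtraction_closed P" "P \<subseteq> H"
        and even: "\<forall>q \<in> carrier (rational_group\<lparr>carrier := H\<rparr> Mod P).
          \<not> has_even_order (rational_group\<lparr>carrier := H\<rparr> Mod P) q"
        and X: "X = (\<lambda>u. u + g) ` (H - P \<inter> C)" using sub_iff by blast
      have "x \<in> P" if "x \<in> H" "x + x \<in> P" for x
        using even that unfolding rational_quotient_no_even_order_iff[OF H P] by blast
      then show ?L
        unfolding semi_iff using semiaffine_complement[OF H P(1) _ C X] by blast
    qed
  qed
qed

end
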